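(* Let $\Gamma$ be a congruence subgroup of $\mathrm{SL}_2(\mathbb Z)$, let $D$ be a negative integer with $D\equiv0,1\pmod4$, let $\mathfrak F_\Gamma$ be a fundamental region for $\Gamma$, and let $\Gamma\text{-}\mathrm{RF}(D)$ be the set of all $\Gamma$-reduced forms of discriminant $D$ with respect to $\mathfrak F_\Gamma$. Then: (1) Any two distinct $\Gamma$-reduced forms in $\Gamma\text{-}\mathrm{RF}(D)$ are not $\Gamma$-equivalent. (2) Every form $Q\in\mathrm{QF}(D)$ is $\Gamma$-equivalent to a unique $\Gamma$-reduced form in $\Gamma\text{-}\mathrm{RF}(D)$. (3) The cardinality of $\Gamma\text{-}\mathrm{RF}(D)$ is independent of the choice of $\mathfrak F_\Gamma$. (4) The cardinality $|\Gamma\text{-}\mathrm{RF}(D)|$ is finite.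
   Context: $\mathbb H$ is the upper half plane, on which $\Gamma$ acts by Möbius transformations. $\mathrm{QF}$ is the set of all primitive positive definite integral binary quadratic forms $Q(x,y)=ax^2+bxy+cy^2$, and $\mathrm{QF}(D)$ is the subset of those of discriminant $b^2-4ac=D$. $\Gamma$ acts on $\mathrm{QF}$ by $(Q\cdot\gamma)(x,y)=Q(\alpha x+\beta y,\gamma'x+\delta y)$ for $\gamma=\begin{pmatrix}\alpha&\beta\\ \gamma'&\delta\end{pmatrix}\in\Gamma$; a form $Q'$ is $\Gamma$-equivalent to $Q$ if $Q'=Q\cdot\gamma$ for some $\gamma\in\Gamma$. For $Q\in\mathrm{QF}$, $\tau_Q$ denotes the unique solution of $Q(x,1)=0$ in $\mathbb H$. A fundamental region $\mathfrak F_\Gamma$ for $\Gamma$ is a subset of $\mathbb H$ containing exactly one point of each $\Gamma$-orbit in $\mathbb H$. A form $Q\in\mathrm{QF}$ is called $\Gamma$-reduced (with respect to $\mathfrak F_\Gamma$) if $\tau_Q\in\mathfrak F_\Gamma$; $\Gamma\text{-}\mathrm{RF}(D)$ is the set of all $\Gamma$-reduced forms in $\mathrm{QF}(D)$. *)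

theory Defs
  imports "HOL-Analysis.Analysis" "HOL-Algebra.Group" "HOL-Number_Theory.Cong"
begin

definition SL2Z :: "(int^2^2) monoid" where
  "SL2Z = \<lparr>carrier = {A. det A = 1}, monoid.mult = (**), one = mat 1\<rparr>"

lemma group_SL2Z: "group SL2Z"
proof (rule groupI)
  fix A assume "A \<in> carrier SL2Z"
  hence A: "det A = 1" by (simp add: SL2Z_def)
  define B :: "int^2^2" where
    "B = vector [vector [A $ 2 $ 2, - A $ 1 $ 2], vector [- A $ 2 $ 1, A $ 1 $ 1]]"
  have "det B = 1" using A by (simp add: det_2 B_def algebra_simps)
  moreover have "B ** A = mat 1"
    using A by (simp add: det_2 B_def matrix_matrix_mult_def mat_def vec_eq_iff forall_2 sum_2
        algebra_simps)
  ultimately show "\<exists>B\<in>carrier SL2Z. B \<otimes>\<^bsub>SL2Z\<^esub> A = \<one>\<^bsub>SL2Z\<^esub>"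
    by (auto simp: SL2Z_def)
qed (auto simp: SL2Z_def det_mul matrix_mul_assoc)

definition principal_congruence_subgroup :: "nat \<Rightarrow> (int^2^2) set" where
  "principal_congruence_subgroup N =
     {A \<in> carrier SL2Z. \<forall>i j. [A $ i $ j = (mat 1 :: int^2^2) $ i $ j] (mod int N)}"

definition congruence_subgroup :: "(int^2^2) set \<Rightarrow> bool" where
  "congruence_subgroup \<Gamma> \<longleftrightarrow>
     subgroup \<Gamma> SL2Z \<and> (\<exists>N\<ge>1. principal_congruence_subgroup N \<subseteq> \<Gamma>)"

definition upper_half_plane :: "complex set" where
  "upper_half_plane = {z. Im z > 0}"

definition moebius :: "int^2^2 \<Rightarrow> complex \<Rightarrow> complex" where
  "moebius A z = (of_int (A $ 1 $ 1) * z + of_int (A $ 1 $ 2)) /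
                 (of_int (A $ 2 $ 1) * z + of_int (A $ 2 $ 2))"

definition moebius_orbit :: "(int^2^2) set \<Rightarrow> complex \<Rightarrow> complex set" where
  "moebius_orbit \<Gamma> z = (\<lambda>A. moebius A z) ` \<Gamma>"

definition fundamental_region :: "(int^2^2) set \<Rightarrow> complex set \<Rightarrow> bool" where
  "fundamental_region \<Gamma> F \<longleftrightarrow>
     F \<subseteq> upper_half_plane \<and>
     (\<forall>z\<in>upper_half_plane. \<exists>!w. w \<in> F \<and> w \<in> moebius_orbit \<Gamma> z)"

text \<open>\<open>QForm a b c\<close> stands for the form $a x^2 + b x y + c y^2$.\<close>

datatype qform = QForm (coeff_a: int) (coeff_b: int) (coeff_c: int)

definition qeval :: "qform \<Rightarrow> 'a::comm_ring_1 \<Rightarrow> 'a \<Rightarrow> 'a" where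
  "qeval Q x y = of_int (coeff_a Q) * x^2 + of_int (coeff_b Q) * x * y + of_int (coeff_c Q) * y^2"

definition discriminant :: "qform \<Rightarrow> int" where
  "discriminant Q = (coeff_b Q)^2 - 4 * coeff_a Q * coeff_c Q"

definition primitive_form :: "qform \<Rightarrow> bool" where
  "primitive_form Q \<longleftrightarrow> Gcd {coeff_a Q, coeff_b Q, coeff_c Q} = 1"

definition positive_definite :: "qform \<Rightarrow> bool" where
  "positive_definite Q \<longleftrightarrow> (\<forall>x y :: real. (x, y) \<noteq> (0, 0) \<longrightarrow> qeval Q x y > 0)"

definition QF :: "qform set" where
  "QF = {Q. primitive_form Q \<and> positive_definite Q}"

definition QF_disc :: "int \<Rightarrow> qform set" where
  "QF_disc D = {Q \<in> QF. discriminant Q = D}"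

text \<open>The coefficients of the substituted form; \<open>qeval_qact\<close> below is the defining
  property of the action.\<close>

definition qact :: "qform \<Rightarrow> int^2^2 \<Rightarrow> qform" where
  "qact Q A = QForm
     (qeval Q (A $ 1 $ 1) (A $ 2 $ 1))
     (2 * coeff_a Q * A $ 1 $ 1 * A $ 1 $ 2
       + coeff_b Q * (A $ 1 $ 1 * A $ 2 $ 2 + A $ 1 $ 2 * A $ 2 $ 1)
       + 2 * coeff_c Q * A $ 2 $ 1 * A $ 2 $ 2)
     (qeval Q (A $ 1 $ 2) (A $ 2 $ 2))"

lemma qeval_qact:
  "qeval (qact Q A) x y =
     qeval Q (of_int (A $ 1 $ 1) * x + of_int (A $ 1 $ 2) * y)
             (of_int (A $ 2 $ 1) * x + of_int (A $ 2 $ 2) * y)"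
  by (simp add: qact_def qeval_def algebra_simps power2_eq_square)

definition qform_equiv :: "(int^2^2) set \<Rightarrow> qform \<Rightarrow> qform \<Rightarrow> bool" where
  "qform_equiv \<Gamma> Q Q' \<longleftrightarrow> (\<exists>A\<in>\<Gamma>. Q' = qact Q A)"

definition qroot :: "qform \<Rightarrow> complex" where
  "qroot Q = (THE z. z \<in> upper_half_plane \<and> qeval Q z 1 = 0)"

lemma qroot_ex1:
  assumes "Q \<in> QF"
  shows "\<exists>!z. z \<in> upper_half_plane \<and> qeval Q z 1 = 0"
proof -
  obtain a b c where Q: "Q = QForm a b c" by (cases Q)
  have pos: "a * x^2 + b * x * y + c * y^2 > 0" if "(x, y) \<noteq> (0, 0)" for x y :: real
    using assms that unfolding QF_def positive_definite_def qeval_def Q by auto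
  have a: "real_of_int a > 0" using pos[of 1 0] by simp
  have "a * (4 * a * c - b^2) > (0::real)"
    using pos[of "-b" "2*a"] a by (simp add: algebra_simps power2_eq_square)
  hence d: "4 * a * c - b^2 > (0::real)" using a by (simp add: zero_less_mult_iff)
  define s where "s = sqrt (4 * a * c - b^2)"
  have s: "s > 0" "s^2 = 4 * a * c - b^2" using d by (auto simp: s_def)
  define w where "w = Complex (-b / (2*a)) (s / (2*a))"
  have root: "qeval Q z 1 = 0 \<longleftrightarrow> z = w \<or> z = cnj w" for z
  proof -
    have 1: "w + cnj w = - of_int b / of_int a" "w * cnj w = of_int c / of_int a"
      using a s by (auto simp: w_def complex_eq_iff field_simps power2_eq_square)
    have "qeval Q z 1 = of_int a * (z^2 - (w + cnj w) * z + w * cnj w)"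
      unfolding 1 Q qeval_def using a by (simp add: field_simps)
    also have "\<dots> = of_int a * ((z - w) * (z - cnj w))"
      by (simp add: algebra_simps power2_eq_square)
    finally show ?thesis using a by simp
  qed
  have "Im w > 0" using a s by (simp add: w_def)
  thus ?thesis unfolding root upper_half_plane_def by (intro ex1I[of _ w]) auto
qed

definition reduced_forms :: "complex set \<Rightarrow> int \<Rightarrow> qform set" where
  "reduced_forms F D = {Q \<in> QF_disc D. qroot Q \<in> F}"

end

theory Submission
  imports Defs
begin

text \<open>
  Taking roots is equivariant: if \<open>A\<close> lies in \<open>SL\<^sub>2(\<int>)\<close>, then the Moebius map of \<open>A\<close> sends
  the root of \<open>Q \<cdot> A\<close> to the root of \<open>Q\<close> (\<open>moebius_qroot_qact\<close>). Moreover a form of given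
  discriminant is determined by its root (\<open>qroot_inj_on\<close>). Hence the reduced forms equivalent to
  \<open>Q\<close> correspond to the points of the fundamental region in the orbit of the root of \<open>Q\<close>, and
  there is exactly one such point. So the reduced forms are a system of representatives for the
  \<open>\<Gamma>\<close>-classes of forms of discriminant \<open>D\<close>, which gives the first two claims. It also gives the
  third: sending a reduced form to the form equivalent to it that is reduced for another region
  is injective, and this applies in both directions.

  For finiteness, Gauss reduction writes every form of discriminant \<open>D\<close> as \<open>R \<cdot> A\<close> with \<open>A\<close> in
  \<open>SL\<^sub>2(\<int>)\<close> and \<open>R\<close> from the finite set given by \<open>\<bar>b\<bar> \<le> a \<le> c\<close>. If \<open>\<Gamma>\<close> contains the principal
  congruence subgroup of level \<open>N\<close>, then \<open>R\<close> and the residues of the entries of \<open>A\<close> modulo \<open>N\<close>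
  determine the \<open>\<Gamma>\<close>-class of \<open>R \<cdot> A\<close>, because matrices \<open>A\<close> and \<open>A'\<close> congruent modulo \<open>N\<close> have
  \<open>A\<^sup>-\<^sup>1 A'\<close> congruent to the identity. So there are only finitely many classes.
\<close>

section \<open>Matrix arithmetic and group structure\<close>

lemma det_2_entries:
  assumes "A \<in> carrier SL2Z"
  shows "A $ 1 $ 1 * A $ 2 $ 2 - A $ 1 $ 2 * A $ 2 $ 1 = 1"
  using assms by (simp add: SL2Z_def det_2)

lemma matrix_mult_entry_2:
  "((A :: int^2^2) ** B) $ i $ j = A $ i $ 1 * B $ 1 $ j + A $ i $ 2 * B $ 2 $ j"
  by (simp add: matrix_matrix_mult_def sum_2)

lemma mat_1_entries_2:
  "(mat 1 :: int^2^2) $ 1 $ 1 = 1" "(mat 1 :: int^2^2) $ 1 $ 2 = 0"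
  "(mat 1 :: int^2^2) $ 2 $ 1 = 0" "(mat 1 :: int^2^2) $ 2 $ 2 = 1"
  by (simp_all add: mat_def)

lemma vector_in_SL2Z:
  assumes "a * d - b * c = 1"
  shows "(vector [vector [a, b], vector [c, d]] :: int^2^2) \<in> carrier SL2Z"
  using assms by (simp add: SL2Z_def det_2)

lemma SL2Z_subgroup_inverse:
  assumes "subgroup \<Gamma> SL2Z" "A \<in> \<Gamma>"
  obtains B where "B \<in> \<Gamma>" "A ** B = mat 1" "B ** A = mat 1"
proof
  interpret group SL2Z by (rule group_SL2Z)
  have "A \<in> carrier SL2Z" using assms subgroup.mem_carrier by metis
  from r_inv[OF this] l_inv[OF this]
  show "A ** inv\<^bsub>SL2Z\<^esub> A = mat 1" "inv\<^bsub>SL2Z\<^esub> A ** A = mat 1"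
    by (simp_all add: SL2Z_def)
  show "inv\<^bsub>SL2Z\<^esub> A \<in> \<Gamma>" using assms by (rule subgroup.m_inv_closed)
qed

lemma SL2Z_subgroupD:
  assumes "subgroup \<Gamma> SL2Z"
  shows "\<Gamma> \<subseteq> carrier SL2Z" "mat 1 \<in> \<Gamma>"
    "\<And>A B. A \<in> \<Gamma> \<Longrightarrow> B \<in> \<Gamma> \<Longrightarrow> A ** B \<in> \<Gamma>"
  using subgroup.subset[OF assms] subgroup.one_closed[OF assms] subgroup.m_closed[OF assms]
  by (simp_all add: SL2Z_def)

lemma subgroup_SL2Z: "subgroup (carrier SL2Z) SL2Z"
  using group.subgroup_self[OF group_SL2Z] .

section \<open>The action on forms\<close>

lemma qact_mat_1: "qact Q (mat 1) = Q"
  by (cases Q) (simp add: qact_def qeval_def mat_1_entries_2)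

lemma qact_mult: "qact (qact Q A) B = qact Q (A ** B)"
  by (simp add: qact_def qeval_def matrix_mult_entry_2 algebra_simps power2_eq_square)

lemma discriminant_qact:
  assumes "A \<in> carrier SL2Z"
  shows "discriminant (qact Q A) = discriminant Q"
proof -
  have "discriminant (qact Q A) =
      discriminant Q * (A $ 1 $ 1 * A $ 2 $ 2 - A $ 1 $ 2 * A $ 2 $ 1)^2"
    by (simp add: discriminant_def qact_def qeval_def algebra_simps power2_eq_square)
  with det_2_entries[OF assms] show ?thesis by simp
qed

lemma positive_definite_qact:
  assumes "A \<in> carrier SL2Z" "positive_definite Q"
  shows "positive_definite (qact Q A)"
  unfolding positive_definite_def
proof (intro allI impI)
  fix x y :: real
  assume nz: "(x, y) \<noteq> (0, 0)"
  define u v where uv: "u = A $ 1 $ 1 * x + A $ 1 $ 2 * y" "v = A $ 2 $ 1 * x + A $ 2 $ 2 * y"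
  have det: "real_of_int (A $ 1 $ 1) * A $ 2 $ 2 - A $ 1 $ 2 * A $ 2 $ 1 = 1"
    using arg_cong[OF det_2_entries[OF assms(1)], of real_of_int] by simp
  have "A $ 2 $ 2 * u - A $ 1 $ 2 * v = x * (A $ 1 $ 1 * A $ 2 $ 2 - A $ 1 $ 2 * A $ 2 $ 1)"
    "A $ 1 $ 1 * v - A $ 2 $ 1 * u = y * (A $ 1 $ 1 * A $ 2 $ 2 - A $ 1 $ 2 * A $ 2 $ 1)"
    by (simp_all add: uv algebra_simps)
  hence "(u, v) \<noteq> (0, 0)" using nz det by auto
  thus "qeval (qact Q A) x y > 0"
    using assms(2) by (simp add: qeval_qact positive_definite_def uv)
qed

text \<open>
  In terms of common divisors, primitivity passes along the action without computing any gcd.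
\<close>

lemma primitive_form_iff:
  "primitive_form Q \<longleftrightarrow>
     (\<forall>d. d dvd coeff_a Q \<and> d dvd coeff_b Q \<and> d dvd coeff_c Q \<longrightarrow> d dvd 1)"
proof -
  let ?g = "Gcd {coeff_a Q, coeff_b Q, coeff_c Q}"
  have dvd: "d dvd ?g \<longleftrightarrow> d dvd coeff_a Q \<and> d dvd coeff_b Q \<and> d dvd coeff_c Q" for d
    by simp
  have "primitive_form Q \<longleftrightarrow> ?g dvd 1"
    unfolding primitive_form_def by (metis dvd_refl is_unit_normalize normalize_Gcd)
  also have "\<dots> \<longleftrightarrow> (\<forall>d. d dvd ?g \<longrightarrow> d dvd 1)" using dvd_trans dvd_refl by blast
  finally show ?thesis unfolding dvd .
qed

lemma dvd_coeffs_qact: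
  assumes "d dvd coeff_a Q" "d dvd coeff_b Q" "d dvd coeff_c Q"
  shows "d dvd coeff_a (qact Q A)" "d dvd coeff_b (qact Q A)" "d dvd coeff_c (qact Q A)"
  using assms by (simp_all add: qact_def qeval_def)

text \<open>
  A common divisor of the new coefficients divides the old ones too, since the inverse matrix
  leads back.
\<close>

lemma primitive_form_qact:
  assumes "A \<in> carrier SL2Z" "primitive_form Q"
  shows "primitive_form (qact Q A)"
proof -
  obtain B where "A ** B = mat 1"
    using SL2Z_subgroup_inverse[OF subgroup_SL2Z assms(1)] by blast
  hence "qact (qact Q A) B = Q" by (simp add: qact_mult qact_mat_1)
  thus ?thesis
    using assms(2) dvd_coeffs_qact[of _ "qact Q A" B] unfolding primitive_form_iff by metis
qed

lemma qact_QF_disc: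
  assumes "A \<in> carrier SL2Z" "Q \<in> QF_disc D"
  shows "qact Q A \<in> QF_disc D"
  using assms(2) positive_definite_qact[OF assms(1)] primitive_form_qact[OF assms(1)]
  by (simp add: QF_disc_def QF_def discriminant_qact[OF assms(1)])

lemma qform_equiv_refl: "subgroup \<Gamma> SL2Z \<Longrightarrow> qform_equiv \<Gamma> Q Q"
  unfolding qform_equiv_def using SL2Z_subgroupD(2)
  by (intro bexI[of _ "mat 1"]) (simp_all add: qact_mat_1)

lemma qform_equiv_sym:
  assumes "subgroup \<Gamma> SL2Z" "qform_equiv \<Gamma> Q Q'"
  shows "qform_equiv \<Gamma> Q' Q"
proof -
  obtain A where A: "A \<in> \<Gamma>" "Q' = qact Q A"
    using assms(2) unfolding qform_equiv_def by blast
  obtain B where B: "B \<in> \<Gamma>" "A ** B = mat 1"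
    using SL2Z_subgroup_inverse[OF assms(1) A(1)] .
  have "Q = qact Q' B" by (simp add: A(2) qact_mult B(2) qact_mat_1)
  with B(1) show ?thesis unfolding qform_equiv_def by blast
qed

lemma qform_equiv_trans:
  assumes "subgroup \<Gamma> SL2Z" "qform_equiv \<Gamma> Q Q'" "qform_equiv \<Gamma> Q' Q''"
  shows "qform_equiv \<Gamma> Q Q''"
proof -
  obtain A B where AB: "A \<in> \<Gamma>" "Q' = qact Q A" "B \<in> \<Gamma>" "Q'' = qact Q' B"
    using assms(2,3) unfolding qform_equiv_def by blast
  have "Q'' = qact Q (A ** B)" by (simp only: AB qact_mult)
  with SL2Z_subgroupD(3)[OF assms(1) AB(1,3)] show ?thesis unfolding qform_equiv_def by blast
qed

section \<open>Roots of forms\<close>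

lemma qroot_in_upper_half_plane: "Q \<in> QF \<Longrightarrow> qroot Q \<in> upper_half_plane"
  and qeval_qroot: "Q \<in> QF \<Longrightarrow> qeval Q (qroot Q) 1 = 0"
  using theI'[OF qroot_ex1] by (auto simp: qroot_def)

lemma qroot_eqI:
  assumes "Q \<in> QF" "z \<in> upper_half_plane" "qeval Q z 1 = 0"
  shows "qroot Q = z"
  unfolding qroot_def using qroot_ex1[OF assms(1)] assms(2,3) by (intro the1_equality) simp_all

lemma qeval_scale: "qeval Q (t * x) (t * y) = t^2 * qeval Q x y"
  by (simp add: qeval_def algebra_simps power2_eq_square)

lemma moebius_denominator_nonzero:
  assumes "A \<in> carrier SL2Z" "z \<in> upper_half_plane"
  shows "of_int (A $ 2 $ 1) * z + of_int (A $ 2 $ 2) \<noteq> 0"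
proof
  assume 0: "of_int (A $ 2 $ 1) * z + of_int (A $ 2 $ 2) = 0"
  have "of_int (A $ 2 $ 1) * Im z = 0" using arg_cong[OF 0, of Im] by simp
  hence "A $ 2 $ 1 = 0" using assms(2) by (simp add: upper_half_plane_def)
  with 0 have "A $ 2 $ 2 = 0" by simp
  with \<open>A $ 2 $ 1 = 0\<close> det_2_entries[OF assms(1)] show False by simp
qed

lemma moebius_in_upper_half_plane:
  assumes "A \<in> carrier SL2Z" "z \<in> upper_half_plane"
  shows "moebius A z \<in> upper_half_plane"
proof -
  define q where "q = of_int (A $ 2 $ 1) * z + of_int (A $ 2 $ 2)"
  have "q \<noteq> 0" using moebius_denominator_nonzero[OF assms] by (simp add: q_def)
  hence pos: "(Re q)^2 + (Im q)^2 > 0"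
    by (simp add: complex_eq_iff sum_power2_gt_zero_iff)
  have "Im (moebius A z) = 
      Im z * (A $ 1 $ 1 * A $ 2 $ 2 - A $ 1 $ 2 * A $ 2 $ 1) / ((Re q)^2 + (Im q)^2)"
    unfolding moebius_def q_def[symmetric] Im_divide by (simp add: q_def algebra_simps)
  moreover have "real_of_int (A $ 1 $ 1) * A $ 2 $ 2 - A $ 1 $ 2 * A $ 2 $ 1 = 1"
    using arg_cong[OF det_2_entries[OF assms(1)], of real_of_int] by simp
  ultimately show ?thesis using pos assms(2) by (simp add: upper_half_plane_def)
qed

text \<open>
  With \<open>q\<close> the denominator of the Moebius map at \<open>z\<close>, the homogeneity of \<open>Q\<close> gives
  \<open>(Q \<cdot> A)(z, 1) = q\<^sup>2 Q(A z, 1)\<close>, so that \<open>A z\<close> is a root of \<open>Q\<close> when \<open>z\<close> is one of \<open>Q \<cdot> A\<close>.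
\<close>

lemma moebius_qroot_qact:
  assumes "A \<in> carrier SL2Z" "Q \<in> QF_disc D"
  shows "moebius A (qroot (qact Q A)) = qroot Q"
proof -
  define z where "z = qroot (qact Q A)"
  define q where "q = of_int (A $ 2 $ 1) * z + of_int (A $ 2 $ 2)"
  have QA: "qact Q A \<in> QF" using qact_QF_disc[OF assms] by (simp add: QF_disc_def)
  have z: "z \<in> upper_half_plane" "qeval (qact Q A) z 1 = 0"
    using QA qroot_in_upper_half_plane qeval_qroot by (simp_all add: z_def)
  have q: "q \<noteq> 0" using moebius_denominator_nonzero[OF assms(1) z(1)] by (simp add: q_def)
  have "q^2 * qeval Q (moebius A z) 1 = qeval Q (q * moebius A z) (q * 1)"
    by (rule qeval_scale[symmetric])
  also have "\<dots> = qeval (qact Q A) z 1"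
    using q by (simp add: qeval_qact moebius_def q_def)
  finally have "qeval Q (moebius A z) 1 = 0" using q z(2) by simp
  thus ?thesis
    using qroot_eqI moebius_in_upper_half_plane[OF assms(1) z(1)] assms(2)
    by (simp add: QF_disc_def z_def)
qed

lemma coeff_a_pos:
  assumes "Q \<in> QF"
  shows "coeff_a Q > 0"
proof -
  have "positive_definite Q" using assms by (simp add: QF_def)
  hence "(1::real, 0::real) \<noteq> (0, 0) \<longrightarrow> qeval Q (1::real) 0 > 0"
    unfolding positive_definite_def by (elim allE)
  thus ?thesis by (simp add: qeval_def)
qed

text \<open>
  These are the relations between roots and coefficients, the roots being \<open>z\<close> and its
  conjugate: \<open>b = - a (z + cnj z)\<close>, \<open>c = a z cnj z\<close>, and \<open>b\<^sup>2 - 4 a c = a\<^sup>2 (z - cnj z)\<^sup>2\<close>.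
\<close>

lemma coeffs_of_root:
  assumes "qeval Q z 1 = 0" "Im z > 0"
  shows "real_of_int (coeff_b Q) = - 2 * coeff_a Q * Re z"
    "real_of_int (coeff_c Q) = coeff_a Q * ((Re z)^2 + (Im z)^2)"
    "- real_of_int (discriminant Q) = (2 * coeff_a Q * Im z)^2"
proof -
  have "Im z * (2 * coeff_a Q * Re z + coeff_b Q) = 0"
    using arg_cong[OF assms(1), of Im] by (simp add: qeval_def power2_eq_square algebra_simps)
  thus b: "real_of_int (coeff_b Q) = - 2 * coeff_a Q * Re z" using assms(2) by simp
  have "coeff_a Q * ((Re z)^2 - (Im z)^2) + coeff_b Q * Re z + coeff_c Q = 0"
    using arg_cong[OF assms(1), of Re] by (simp add: qeval_def power2_eq_square algebra_simps)
  thus c: "real_of_int (coeff_c Q) = coeff_a Q * ((Re z)^2 + (Im z)^2)"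
    by (simp add: b power2_eq_square algebra_simps)
  show "- real_of_int (discriminant Q) = (2 * coeff_a Q * Im z)^2"
    by (simp add: discriminant_def b c power2_eq_square algebra_simps)
qed

text \<open>
  The root fixes the coefficients up to a common factor; the discriminant then fixes \<open>a\<^sup>2\<close>, and
  positivity the sign of \<open>a\<close>.
\<close>

lemma qroot_inj_on: "inj_on qroot (QF_disc D)"
proof (rule inj_onI)
  fix Q Q' assume Q: "Q \<in> QF_disc D" and Q': "Q' \<in> QF_disc D" and eq: "qroot Q = qroot Q'"
  define z where "z = qroot Q"
  have QF: "Q \<in> QF" "Q' \<in> QF" using Q Q' by (simp_all add: QF_disc_def)
  have Im: "Im z > 0"
    using qroot_in_upper_half_plane[OF QF(1)] by (simp add: upper_half_plane_def z_def)
  have root: "qeval Q z 1 = 0" "qeval Q' z 1 = 0"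
    using qeval_qroot[OF QF(1)] qeval_qroot[OF QF(2)] eq by (simp_all add: z_def)
  note cf = coeffs_of_root[OF root(1) Im] and cf' = coeffs_of_root[OF root(2) Im]
  have "(2 * coeff_a Q * Im z)^2 = (2 * coeff_a Q' * Im z)^2"
    using cf(3) cf'(3) Q Q' by (simp add: QF_disc_def)
  hence "real_of_int (coeff_a Q)^2 = real_of_int (coeff_a Q')^2"
    using Im by (simp add: power_mult_distrib)
  moreover have "real_of_int (coeff_a Q) \<ge> 0" "real_of_int (coeff_a Q') \<ge> 0"
    using coeff_a_pos[OF QF(1)] coeff_a_pos[OF QF(2)] by linarith+
  ultimately have a: "coeff_a Q = coeff_a Q'" by (metis power2_eq_iff_nonneg of_int_eq_iff)
  have "real_of_int (coeff_b Q) = coeff_b Q'" "real_of_int (coeff_c Q) = coeff_c Q'"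
    by (simp_all only: cf cf' a)
  with a show "Q = Q'" by (intro qform.expand) simp
qed

section \<open>Reduced forms represent the classes\<close>

text \<open>
  Acting by \<open>A\<close> on forms acts by the inverse of \<open>A\<close> on roots. This is why this lemma and the next
  pass to inverses in \<open>\<Gamma>\<close>.
\<close>

lemma qform_equiv_imp_orbit:
  assumes "subgroup \<Gamma> SL2Z" "Q \<in> QF_disc D" "qform_equiv \<Gamma> Q Q'"
  shows "qroot Q' \<in> moebius_orbit \<Gamma> (qroot Q)"
proof -
  obtain A where A: "A \<in> \<Gamma>" "Q = qact Q' A"
    using qform_equiv_sym[OF assms(1,3)] unfolding qform_equiv_def by blast
  obtain B where B: "B \<in> \<Gamma>" "Q' = qact Q B"
    using assms(3) unfolding qform_equiv_def by blast
  have "Q' \<in> QF_disc D"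
    using B qact_QF_disc assms(2) SL2Z_subgroupD(1)[OF assms(1)] by blast
  hence "moebius A (qroot Q) = qroot Q'"
    using moebius_qroot_qact[of A Q' D] A SL2Z_subgroupD(1)[OF assms(1)] by blast
  thus ?thesis unfolding moebius_orbit_def using A(1) by (metis image_eqI)
qed

lemma orbit_imp_qform_equiv:
  assumes "subgroup \<Gamma> SL2Z" "Q \<in> QF_disc D" "w \<in> moebius_orbit \<Gamma> (qroot Q)"
  obtains Q' where "Q' \<in> QF_disc D" "qform_equiv \<Gamma> Q Q'" "qroot Q' = w"
proof -
  obtain A where A: "A \<in> \<Gamma>" "w = moebius A (qroot Q)"
    using assms(3) by (auto simp: moebius_orbit_def)
  obtain B where B: "B \<in> \<Gamma>" "B ** A = mat 1"
    using SL2Z_subgroup_inverse[OF assms(1) A(1)] by blast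
  have SL: "A \<in> carrier SL2Z" "B \<in> carrier SL2Z"
    using A B SL2Z_subgroupD(1)[OF assms(1)] by auto
  have Q': "qact Q B \<in> QF_disc D" using qact_QF_disc[OF SL(2) assms(2)] .
  have "qact (qact Q B) A = Q" by (simp add: qact_mult B qact_mat_1)
  hence "qroot (qact Q B) = w" using moebius_qroot_qact[OF SL(1) Q'] A by simp
  with Q' B show thesis using that by (auto simp: qform_equiv_def)
qed

lemma reduced_form_unique:
  assumes "subgroup \<Gamma> SL2Z" "fundamental_region \<Gamma> F" "Q \<in> QF_disc D"
    and "Q1 \<in> reduced_forms F D" "qform_equiv \<Gamma> Q Q1"
    and "Q2 \<in> reduced_forms F D" "qform_equiv \<Gamma> Q Q2"
  shows "Q1 = Q2"
proof -
  have "qroot Q \<in> upper_half_plane"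
    using assms(3) qroot_in_upper_half_plane by (simp add: QF_disc_def)
  moreover have "qroot Q1 \<in> F" "qroot Q2 \<in> F" using assms by (auto simp: reduced_forms_def)
  ultimately have "qroot Q1 = qroot Q2"
    using assms(2) qform_equiv_imp_orbit[OF assms(1,3)] assms(5,7)
    unfolding fundamental_region_def by blast
  thus ?thesis using qroot_inj_on assms(4,6) unfolding inj_on_def reduced_forms_def by blast
qed

lemma reduced_form_exists:
  assumes "subgroup \<Gamma> SL2Z" "fundamental_region \<Gamma> F" "Q \<in> QF_disc D"
  shows "\<exists>Q'. Q' \<in> reduced_forms F D \<and> qform_equiv \<Gamma> Q Q'"
proof -
  have "qroot Q \<in> upper_half_plane"
    using assms(3) qroot_in_upper_half_plane by (simp add: QF_disc_def)
  then obtain w where w: "w \<in> F" "w \<in> moebius_orbit \<Gamma> (qroot Q)"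
    using assms(2) unfolding fundamental_region_def by blast
  obtain Q' where "Q' \<in> QF_disc D" "qform_equiv \<Gamma> Q Q'" "qroot Q' = w"
    using orbit_imp_qform_equiv[OF assms(1,3) w(2)] .
  with w(1) show ?thesis by (auto simp: reduced_forms_def)
qed

lemma equivalent_reduced_forms_eq:
  assumes "subgroup \<Gamma> SL2Z" "fundamental_region \<Gamma> F"
    and "Q \<in> reduced_forms F D" "Q' \<in> reduced_forms F D" "qform_equiv \<Gamma> Q Q'"
  shows "Q = Q'"
  using reduced_form_unique[OF assms(1,2) _ assms(3) qform_equiv_refl[OF assms(1)] assms(4,5)]
    assms(3) by (simp add: reduced_forms_def)

text \<open>
  Two reduced forms with the same reduced partner in \<open>F'\<close> are equivalent to each other, hence
  equal.
\<close>

lemma reduced_forms_lepoll: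
  assumes "subgroup \<Gamma> SL2Z" "fundamental_region \<Gamma> F" "fundamental_region \<Gamma> F'"
  shows "reduced_forms F D \<lesssim> reduced_forms F' D"
proof -
  have "\<forall>Q\<in>reduced_forms F D. \<exists>Q'. Q' \<in> reduced_forms F' D \<and> qform_equiv \<Gamma> Q Q'"
    using reduced_form_exists[OF assms(1,3)] by (auto simp: reduced_forms_def)
  then obtain f where f: "\<And>Q. Q \<in> reduced_forms F D \<Longrightarrow>
      f Q \<in> reduced_forms F' D \<and> qform_equiv \<Gamma> Q (f Q)"
    by metis
  have "inj_on f (reduced_forms F D)"
  proof (rule inj_onI)
    fix Q R assume QR: "Q \<in> reduced_forms F D" "R \<in> reduced_forms F D" "f Q = f R"
    hence "qform_equiv \<Gamma> Q R"
      using f qform_equiv_sym[OF assms(1)] qform_equiv_trans[OF assms(1)] by metis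
    thus "Q = R" using equivalent_reduced_forms_eq[OF assms(1,2)] QR by blast
  qed
  moreover have "f ` reduced_forms F D \<subseteq> reduced_forms F' D" using f by blast
  ultimately show ?thesis unfolding lepoll_def by blast
qed

section \<open>Gauss reduction and finiteness\<close>

definition gauss_reduced_forms :: "int \<Rightarrow> qform set" where
  "gauss_reduced_forms D = {Q \<in> QF_disc D. \<bar>coeff_b Q\<bar> \<le> coeff_a Q \<and> coeff_a Q \<le> coeff_c Q}"

text \<open>
  From \<open>b\<^sup>2 \<le> a\<^sup>2 \<le> a c\<close> follows \<open>- D = 4 a c - b\<^sup>2 \<ge> 3 a\<^sup>2\<close>, which bounds \<open>a\<close> and so \<open>b\<close>; and
  \<open>4 a c = b\<^sup>2 - D\<close> then bounds \<open>c\<close>.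
\<close>

lemma finite_gauss_reduced_forms: "finite (gauss_reduced_forms D)"
proof -
  have "gauss_reduced_forms D \<subseteq>
    (\<lambda>(a, b, c). QForm a b c) ` ({0..-D} \<times> {D..-D} \<times> {0..D\<^sup>2 - D})"
  proof
    fix Q assume Q: "Q \<in> gauss_reduced_forms D"
    obtain a b c where abc: "Q = QForm a b c" by (cases Q)
    have a: "a > 0" "\<bar>b\<bar> \<le> a" "a \<le> c" and D: "b^2 - 4 * a * c = D"
      using Q coeff_a_pos[of Q]
      by (auto simp: gauss_reduced_forms_def QF_disc_def discriminant_def abc)
    have bb: "b^2 \<le> a^2" using a(2) by (metis abs_le_square_iff abs_of_pos a(1))
    have "a * a \<le> a * c" using a by (intro mult_left_mono) auto
    moreover have "a \<le> a * a" "c \<le> a * c"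
      using a by (simp_all add: mult_le_cancel_right1 mult_le_cancel_left1)
    moreover have "4 * (a * c) \<le> a * a - D" using D bb by (simp add: power2_eq_square)
    ultimately have "a \<le> - D" "c \<le> a^2 - D"
      unfolding power2_eq_square using a by linarith+
    moreover have "a^2 \<le> D^2" using \<open>a \<le> - D\<close> a(1) by (intro abs_le_square_iff[THEN iffD1]) auto
    ultimately show "Q \<in> (\<lambda>(a, b, c). QForm a b c) ` ({0..-D} \<times> {D..-D} \<times> {0..D\<^sup>2 - D})"
      using a unfolding abc by (intro image_eqI[of _ _ "(a, b, c)"]) auto
  qed
  thus ?thesis by (rule finite_subset) simp
qed

lemma qact_translation:
  "qact (QForm a b c) (vector [vector [1, k], vector [0, 1]]) =
     QForm a (b + 2 * a * k) (a * k^2 + b * k + c)"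
  by (simp add: qact_def qeval_def)

lemma qact_inversion:
  "qact (QForm a b c) (vector [vector [0, - 1], vector [1, 0]]) = QForm c (- b) a"
  by (simp add: qact_def qeval_def)

text \<open>
  In the \<open>SL\<^sub>2(\<int>)\<close>-class of \<open>Q\<close> take a form with least \<open>a\<close>. A translation makes \<open>\<bar>b\<bar> \<le> a\<close> and
  keeps \<open>a\<close>. The inversion then exchanges \<open>a\<close> and \<open>c\<close>, so \<open>c < a\<close> would contradict the choice.
\<close>

lemma gauss_reduction:
  assumes "Q \<in> QF_disc D"
  shows "\<exists>R\<in>gauss_reduced_forms D. qform_equiv (carrier SL2Z) R Q"
proof -
  note refl = qform_equiv_refl[OF subgroup_SL2Z] and sym = qform_equiv_sym[OF subgroup_SL2Z]
    and trans = qform_equiv_trans[OF subgroup_SL2Z]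
  let ?E = "qform_equiv (carrier SL2Z) Q"
  obtain R where R: "?E R" and least: "\<And>S. ?E S \<Longrightarrow> nat (coeff_a R) \<le> nat (coeff_a S)"
    using ex_has_least_nat[of ?E Q "\<lambda>S. nat (coeff_a S)"] refl by blast
  obtain a b c where abc: "R = QForm a b c" by (cases R)
  have disc: "S \<in> QF_disc D" if "?E S" for S
    using that assms qact_QF_disc by (auto simp: qform_equiv_def)
  have a: "a > 0" using coeff_a_pos[of R] disc[OF R] by (simp add: QF_disc_def abc)
  \<comment> \<open>The quotient that brings \<open>b + 2 a k\<close> into the interval from \<open>- a\<close> to \<open>a\<close>, of length
    \<open>2 a\<close>.\<close>
  define k where "k = - ((b + a) div (2 * a))"
  define S where "S = QForm a (b + 2 * a * k) (a * k^2 + b * k + c)"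
  have "qform_equiv (carrier SL2Z) R S"
    unfolding qform_equiv_def abc S_def qact_translation[symmetric]
    using vector_in_SL2Z[of 1 1 k 0] by auto
  hence S: "?E S" using R trans by blast
  have "b + 2 * a * k = (b + a) mod (2 * a) - a"
    by (simp add: k_def minus_div_mult_eq_mod[symmetric] algebra_simps)
  moreover have "0 \<le> (b + a) mod (2 * a)" "(b + a) mod (2 * a) < 2 * a" using a by simp_all
  ultimately have b: "\<bar>coeff_b S\<bar> \<le> coeff_a S" by (simp add: S_def)
  define T where "T = QForm (coeff_c S) (- coeff_b S) (coeff_a S)"
  have "qform_equiv (carrier SL2Z) S T"
    unfolding qform_equiv_def T_def qact_inversion[symmetric]
    using vector_in_SL2Z[of 0 0 "-1" 1] by auto
  hence T: "?E T" using S trans by blast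
  hence "coeff_c S > 0" using coeff_a_pos[of T] disc by (simp add: QF_disc_def T_def)
  hence "coeff_a S \<le> coeff_c S" using least[OF T] by (simp add: abc S_def T_def)
  hence "S \<in> gauss_reduced_forms D" using b disc[OF S] by (simp add: gauss_reduced_forms_def)
  thus ?thesis using sym[OF S] by blast
qed

lemma congruent_matrices_quotient:
  assumes "A \<in> carrier SL2Z" "A' \<in> carrier SL2Z" "\<And>i j. [A $ i $ j = A' $ i $ j] (mod int N)"
  shows "\<exists>B\<in>principal_congruence_subgroup N. A ** B = A'"
proof -
  obtain C where C: "C \<in> carrier SL2Z" "A ** C = mat 1" "C ** A = mat 1"
    using SL2Z_subgroup_inverse[OF subgroup_SL2Z assms(1)] .
  have "[(C ** A') $ i $ j = (C ** A) $ i $ j] (mod int N)" for i j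
    unfolding matrix_mult_entry_2 by (intro cong_add cong_mult cong_refl cong_sym[OF assms(3)])
  moreover have "C ** A' \<in> carrier SL2Z" using SL2Z_subgroupD(3)[OF subgroup_SL2Z] C assms by blast
  ultimately have "C ** A' \<in> principal_congruence_subgroup N"
    unfolding principal_congruence_subgroup_def C(3) by blast
  moreover have "A ** (C ** A') = A'" by (simp add: matrix_mul_assoc C)
  ultimately show ?thesis by blast
qed

text \<open>
  The label of a form \<open>R \<cdot> A\<close> records \<open>R\<close> and the entries of \<open>A\<close> modulo \<open>N\<close>, so there are finitely
  many labels; forms with equal labels differ by an element of the principal congruence subgroup
  and thus are \<open>\<Gamma>\<close>-equivalent.
\<close>

lemma finite_reduced_forms:
  assumes "congruence_subgroup \<Gamma>" "fundamental_region \<Gamma> F"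
  shows "finite (reduced_forms F D)"
proof -
  obtain N :: nat where N: "N \<ge> 1" "principal_congruence_subgroup N \<subseteq> \<Gamma>"
    and sub: "subgroup \<Gamma> SL2Z"
    using assms(1) by (auto simp: congruence_subgroup_def)
  have "\<forall>Q\<in>reduced_forms F D. \<exists>R A. R \<in> gauss_reduced_forms D \<and> A \<in> carrier SL2Z \<and> Q = qact R A"
    using gauss_reduction unfolding reduced_forms_def qform_equiv_def by blast
  then obtain R A where RA: "\<And>Q. Q \<in> reduced_forms F D \<Longrightarrow>
      R Q \<in> gauss_reduced_forms D \<and> A Q \<in> carrier SL2Z \<and> Q = qact (R Q) (A Q)"
    by metis
  define label where "label Q = (R Q, \<lambda>p. A Q $ fst p $ snd p mod int N)" for Q
  have "inj_on label (reduced_forms F D)"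
  proof (rule inj_onI)
    fix Q Q' assume Q: "Q \<in> reduced_forms F D" and Q': "Q' \<in> reduced_forms F D"
      and eq: "label Q = label Q'"
    have "[A Q $ i $ j = A Q' $ i $ j] (mod int N)" for i j
      using eq unfolding label_def cong_def prod.inject by (metis fst_conv snd_conv)
    then obtain B where B: "B \<in> principal_congruence_subgroup N" "A Q ** B = A Q'"
      using congruent_matrices_quotient RA[OF Q] RA[OF Q'] by blast
    have "R Q = R Q'" using eq by (simp add: label_def)
    hence "Q' = qact Q B" using RA[OF Q] RA[OF Q'] B(2) by (metis qact_mult)
    hence "qform_equiv \<Gamma> Q Q'" using B(1) N(2) by (auto simp: qform_equiv_def)
    thus "Q = Q'" using equivalent_reduced_forms_eq[OF sub assms(2) Q Q'] by blast
  qed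
  moreover have "label ` reduced_forms F D \<subseteq>
      gauss_reduced_forms D \<times> (UNIV \<rightarrow>\<^sub>E {0..<int N})"
    using RA N(1) by (auto simp: label_def)
  moreover have "finite (gauss_reduced_forms D \<times>
      ((UNIV :: (2 \<times> 2) set) \<rightarrow>\<^sub>E {0..<int N}))"
    by (intro finite_cartesian_product finite_gauss_reduced_forms finite_PiE) auto
  ultimately show ?thesis by (meson finite_subset finite_imageD)
qed

section \<open>Class representatives\<close>

theorem theorem3p1:
  fixes \<Gamma> :: "(int^2^2) set" and D :: int and F :: "complex set"
  assumes "congruence_subgroup \<Gamma>"
    and "D < 0" and "[D = 0] (mod 4) \<or> [D = 1] (mod 4)"
    and "fundamental_region \<Gamma> F"
  shows "(\<forall>Q\<in>reduced_forms F D. \<forall>Q'\<in>reduced_forms F D. Q \<noteq> Q' \<longrightarrow> \<not> qform_equiv \<Gamma> Q Q') \<and>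
    (\<forall>Q\<in>QF_disc D. \<exists>!Q'. Q' \<in> reduced_forms F D \<and> qform_equiv \<Gamma> Q Q') \<and>
    (\<forall>F'. fundamental_region \<Gamma> F' \<longrightarrow> reduced_forms F D \<approx> reduced_forms F' D) \<and>
    finite (reduced_forms F D)"
proof (intro conjI ballI allI impI)
  have sub: "subgroup \<Gamma> SL2Z" using assms(1) by (simp add: congruence_subgroup_def)
  show "\<not> qform_equiv \<Gamma> Q Q'"
    if "Q \<in> reduced_forms F D" "Q' \<in> reduced_forms F D" "Q \<noteq> Q'" for Q Q'
    using equivalent_reduced_forms_eq[OF sub assms(4)] that by blast
  show "\<exists>!Q'. Q' \<in> reduced_forms F D \<and> qform_equiv \<Gamma> Q Q'" if "Q \<in> QF_disc D" for Q
    using reduced_form_exists[OF sub assms(4) that] reduced_form_unique[OF sub assms(4) that]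
    by blast
  show "reduced_forms F D \<approx> reduced_forms F' D" if "fundamental_region \<Gamma> F'" for F'
    using reduced_forms_lepoll[OF sub assms(4) that] reduced_forms_lepoll[OF sub that assms(4)]
    by (rule lepoll_antisym)
  show "finite (reduced_forms F D)" using finite_reduced_forms[OF assms(1,4)] .
qed

end
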